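(* Let $\Gamma$ be a taking and breaking game with fixed rules, fix a positive integer $n$, and let $H_n=\{h_1,\dots,h_n\}$ and $\mathcal{F}_{H_n}$ be the free commutative monoid on $H_n$ (the positions of $\Gamma$ with no heap larger than $n$). Let $\mathcal{Q}$ be a finite commutative monoid with identity $e$, let $\mathcal{Q}=P\cup N$ be a partition of $\mathcal{Q}$ into two nonempty parts, and let $\Phi:H\to\mathcal{Q}$ be a function, extended multiplicatively to positions (with $\Phi$ of the empty position equal to $e$). Say that a position $p$ is asserted to be of type $\omega$ if $\Phi(p)=\omega$, and is asserted to be a $P$-position if $\Phi(p)\in P$. For a nonempty subset $U\subseteq H_n$ let $P(U)=\prod_{h_i\in U}h_i\in\mathcal{F}_{H_n}$, $\Phi(U)=\prod_{h_i\in U}\Phi(h_i)$, let $\mathcal{S}(U)$ be the submonoid of $\mathcal{Q}$ generated by $e$ and the elements $\Phi(h_i)$, $h_i\in U$, and for $h_i\in U$ let $P(U)/h_i$ denote the position obtained from $P(U)$ by deleting the heap $h_i$. Let $\omega\in N$. Then the following are equivalent: (1) every position $p\in\mathcal{F}_{H_n}$ other than the empty position with $\Phi(p)=\omega$ has a legal move of $\Gamma$ to a position $q$ with $\Phi(q)\in P$; (2) for every nonempty subset $U\subseteq H_n$ and every $s\in\mathcal{S}(U)$ with $\omega=s\cdot\Phi(U)$, there exist a heap $h_i\in U$ and a legal move $h_i\to t$ of $\Gamma$ such that $s\cdot\Phi(t)\cdot\Phi(P(U)/h_i)\in P$.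
   Context: A taking and breaking game is an impartial game played on heaps of counters; a move consists of choosing one heap $h_i$ (a heap of $i$ counters) and replacing it by a position $t$ (a possibly empty collection of smaller heaps) as permitted by the rules; this is written $h_i\to t$. Positions are written multiplicatively as products of heap symbols, the product corresponding to disjoint union of heaps, and $H=\{h_1,h_2,\dots\}$. *)

theory Defs
  imports "HOL-Library.Multiset" "HOL.Hull"
begin

text \<open>
  The heap of \<open>i\<close> counters is represented by the number \<open>i \<ge> 1\<close>, and a position by the
  finite multiset of its heaps. The multiplicative notation for positions thus becomes the
  additive notation for multisets: the disjoint union of \<open>p\<close> and \<open>q\<close> is \<open>p + q\<close>, and the
  empty position is \<open>{#}\<close>.
\<close>

type_synonym position = "nat multiset"

definition positions_upto :: "nat \<Rightarrow> position set" where
  "positions_upto n = {p. set_mset p \<subseteq> {1..n}}"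

text \<open>
  The rules are a relation: \<open>R i t\<close> says that a heap of \<open>i\<close> counters may be replaced by
  the position \<open>t\<close>.
\<close>

definition taking_breaking_game :: "(nat \<Rightarrow> position \<Rightarrow> bool) \<Rightarrow> bool" where
  "taking_breaking_game R \<longleftrightarrow>
     (\<forall>i t. R i t \<longrightarrow> 1 \<le> i \<and> (\<forall>j \<in># t. 1 \<le> j \<and> j < i))"

definition legal_move :: "(nat \<Rightarrow> position \<Rightarrow> bool) \<Rightarrow> position \<Rightarrow> position \<Rightarrow> bool" where
  "legal_move R p q \<longleftrightarrow> (\<exists>i t. i \<in># p \<and> R i t \<and> q = (p - {#i#}) + t)"

definition extend :: "(nat \<Rightarrow> 'q::comm_monoid_mult) \<Rightarrow> position \<Rightarrow> 'q" where
  "extend \<Phi> p = (\<Prod>i \<in># p. \<Phi> i)"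

definition is_submonoid :: "'q::comm_monoid_mult set \<Rightarrow> bool" where
  "is_submonoid S \<longleftrightarrow> 1 \<in> S \<and> (\<forall>x \<in> S. \<forall>y \<in> S. x * y \<in> S)"

definition support_submonoid :: "(nat \<Rightarrow> 'q::comm_monoid_mult) \<Rightarrow> nat set \<Rightarrow> 'q set" where
  "support_submonoid \<Phi> U = is_submonoid hull (insert 1 (\<Phi> ` U))"

text \<open>The position with exactly one heap of each size in the finite set \<open>U\<close>.\<close>

definition set_position :: "nat set \<Rightarrow> position" where
  "set_position U = mset_set U"

end

theory Submission
  imports Defs
begin

text \<open>
  A nonempty position with support \<open>U\<close> is one heap of each size in \<open>U\<close> together with some
  position \<open>w\<close> on \<open>U\<close>, and the values \<open>s\<close> of such \<open>w\<close> are exactly the elements of the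
  submonoid generated by \<open>\<Phi> ` U\<close>. A move on the whole position acts on a heap whose size lies
  in \<open>U\<close>, so it may be taken to act on the copy in \<open>P(U)\<close>, and its value then depends on \<open>w\<close>
  only through \<open>s\<close>.
\<close>

lemma extend_empty [simp]: "extend \<Phi> {#} = 1"
  by (simp add: extend_def)

lemma extend_add_mset [simp]: "extend \<Phi> (add_mset i p) = \<Phi> i * extend \<Phi> p"
  by (simp add: extend_def)

lemma extend_union [simp]: "extend \<Phi> (p + q) = extend \<Phi> p * extend \<Phi> q"
  by (simp add: extend_def)

lemma extend_set_position: "extend \<Phi> (set_position U) = (\<Prod>i\<in>U. \<Phi> i)"
  by (simp add: extend_def set_position_def prod_unfold_prod_mset)

text \<open>Disjoint union of positions turns into multiplication of values, so the right-hand side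
  is itself a submonoid containing the generators. Induction on \<open>w\<close> puts it inside
  every other such submonoid. This lets an abstract \<open>s\<close> be realised by an actual
  position.\<close>

lemma support_submonoid_eq: "support_submonoid \<Phi> U = extend \<Phi> ` {w. set_mset w \<subseteq> U}"
  unfolding support_submonoid_def
proof (rule hull_unique)
  have "1 \<in> extend \<Phi> ` {w. set_mset w \<subseteq> U}"
    by (rule image_eqI [of _ _ "{#}"]) auto
  moreover have "\<Phi> i \<in> extend \<Phi> ` {w. set_mset w \<subseteq> U}" if "i \<in> U" for i
    using that by (intro image_eqI [of _ _ "{#i#}"]) auto
  ultimately show "insert 1 (\<Phi> ` U) \<subseteq> extend \<Phi> ` {w. set_mset w \<subseteq> U}"
    by blast
  show "is_submonoid (extend \<Phi> ` {w. set_mset w \<subseteq> U})"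
    unfolding is_submonoid_def
  proof (intro conjI ballI)
    show "1 \<in> extend \<Phi> ` {w. set_mset w \<subseteq> U}"
      by (rule image_eqI [of _ _ "{#}"]) auto
  next
    fix x y
    assume "x \<in> extend \<Phi> ` {w. set_mset w \<subseteq> U}" "y \<in> extend \<Phi> ` {w. set_mset w \<subseteq> U}"
    then obtain v w where "x = extend \<Phi> v" "set_mset v \<subseteq> U" "y = extend \<Phi> w" "set_mset w \<subseteq> U"
      by auto
    then show "x * y \<in> extend \<Phi> ` {w. set_mset w \<subseteq> U}"
      by (intro image_eqI [of _ _ "v + w"]) auto
  qed
next
  fix S assume S: "insert 1 (\<Phi> ` U) \<subseteq> S" "is_submonoid S"
  have "extend \<Phi> w \<in> S" if "set_mset w \<subseteq> U" for w
    using that S by (induction w) (auto simp: is_submonoid_def)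
  then show "extend \<Phi> ` {w. set_mset w \<subseteq> U} \<subseteq> S"
    by auto
qed

text \<open>Both sides range over the same pairs of a heap size in \<open>U\<close> and a
  replacement \<open>t\<close>, and matching pairs yield the same value. Being an equivalence, it
  serves both directions of the theorem.\<close>

lemma legal_move_set_position_iff:
  assumes "finite U" and "set_mset w \<subseteq> U"
  shows "(\<exists>q. legal_move R (w + set_position U) q \<and> extend \<Phi> q \<in> P) \<longleftrightarrow>
    (\<exists>i\<in>U. \<exists>t. R i t \<and> extend \<Phi> w * extend \<Phi> t * extend \<Phi> (set_position U - {#i#}) \<in> P)"
proof -
  have mem: "i \<in># w + set_position U \<longleftrightarrow> i \<in> U" for i
    using assms by (auto simp: set_position_def)
  have val: "extend \<Phi> (w + set_position U - {#i#} + t) =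
      extend \<Phi> w * extend \<Phi> t * extend \<Phi> (set_position U - {#i#})" if "i \<in> U" for i t
  proof -
    have "i \<in># set_position U"
      using assms that by (simp add: set_position_def)
    \<comment> \<open>Multiset subtraction is truncated, so this regrouping depends on
      \<open>i\<close> occurring in \<open>set_position U\<close>.\<close>
    then have "w + set_position U - {#i#} = w + (set_position U - {#i#})"
      by simp
    then show ?thesis
      by (simp only: extend_union ac_simps)
  qed
  have "(\<exists>q. legal_move R (w + set_position U) q \<and> extend \<Phi> q \<in> P) \<longleftrightarrow>
      (\<exists>i\<in>U. \<exists>t. R i t \<and> extend \<Phi> (w + set_position U - {#i#} + t) \<in> P)"
    unfolding legal_move_def mem by blast
  then show ?thesis
    \<comment> \<open>The congruence rule supplies \<open>i \<in> U\<close>, the side condition of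
      \<open>val\<close>.\<close>
    by (simp only: val cong: bex_cong)
qed

theorem theorem2:
  fixes R :: "nat \<Rightarrow> position \<Rightarrow> bool"
    and n :: nat
    and P N :: "'q::{comm_monoid_mult, finite} set"
    and \<Phi> :: "nat \<Rightarrow> 'q"
    and \<omega> :: 'q
  assumes "taking_breaking_game R"
    and "0 < n"
    and "P \<union> N = UNIV" and "P \<inter> N = {}" and "P \<noteq> {}" and "N \<noteq> {}"
    and "\<omega> \<in> N"
  shows "(\<forall>p \<in> positions_upto n. p \<noteq> {#} \<and> extend \<Phi> p = \<omega> \<longrightarrow>
            (\<exists>q. legal_move R p q \<and> extend \<Phi> q \<in> P))
     \<longleftrightarrow>
         (\<forall>U. U \<subseteq> {1..n} \<and> U \<noteq> {} \<longrightarrow>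
            (\<forall>s \<in> support_submonoid \<Phi> U. \<omega> = s * (\<Prod>i\<in>U. \<Phi> i) \<longrightarrow>
              (\<exists>i \<in> U. \<exists>t. R i t \<and>
                 s * extend \<Phi> t * extend \<Phi> (set_position U - {#i#}) \<in> P)))"
  (is "?L \<longleftrightarrow> ?R")
proof
  assume L: ?L
  show ?R
  proof (intro allI impI ballI)
    fix U s
    assume U: "U \<subseteq> {1..n} \<and> U \<noteq> {}" and "s \<in> support_submonoid \<Phi> U"
      and \<omega>: "\<omega> = s * (\<Prod>i\<in>U. \<Phi> i)"
    then obtain w where w: "set_mset w \<subseteq> U" "s = extend \<Phi> w"
      by (auto simp: support_submonoid_eq)
    have fin: "finite U"
      using U finite_subset by blast
    let ?p = "w + set_position U"
    \<comment> \<open>Adding \<open>w\<close> creates no new heap size, so \<open>?p\<close>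
      inherits the bound \<open>n\<close> and nonemptiness from \<open>U\<close>.\<close>
    have "set_mset ?p = U"
      using fin w by (auto simp: set_position_def)
    then have "?p \<in> positions_upto n" "?p \<noteq> {#}"
      using U by (auto simp: positions_upto_def)
    moreover have "extend \<Phi> ?p = \<omega>"
      using \<omega> w by (simp add: extend_set_position)
    ultimately have "\<exists>q. legal_move R ?p q \<and> extend \<Phi> q \<in> P"
      using L by blast
    then show "\<exists>i\<in>U. \<exists>t. R i t \<and> s * extend \<Phi> t * extend \<Phi> (set_position U - {#i#}) \<in> P"
      unfolding legal_move_set_position_iff [OF fin w(1)] w(2) .
  qed
next
  assume R: ?R
  show ?L
  proof (intro ballI impI)
    fix p assume p: "p \<in> positions_upto n" "p \<noteq> {#} \<and> extend \<Phi> p = \<omega>"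
    define U where "U = set_mset p"
    define w where "w = p - set_position U"
    \<comment> \<open>Each size in the support of \<open>p\<close> occurs at least once, so the
      subtraction defining \<open>w\<close> truncates nothing.\<close>
    have p_eq: "w + set_position U = p"
      by (simp add: w_def U_def set_position_def mset_set_set_mset_msubset)
    have w: "set_mset w \<subseteq> U"
      unfolding w_def U_def by (auto dest: in_diffD)
    then have "extend \<Phi> w \<in> support_submonoid \<Phi> U"
      by (auto simp: support_submonoid_eq)
    moreover have "\<omega> = extend \<Phi> w * (\<Prod>i\<in>U. \<Phi> i)"
      using p p_eq by (metis extend_set_position extend_union)
    moreover have "U \<subseteq> {1..n} \<and> U \<noteq> {}"
      using p by (auto simp: U_def positions_upto_def)
    ultimately have "\<exists>i\<in>U. \<exists>t. R i t \<and>
        extend \<Phi> w * extend \<Phi> t * extend \<Phi> (set_position U - {#i#}) \<in> P"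
      using R by blast
    then show "\<exists>q. legal_move R p q \<and> extend \<Phi> q \<in> P"
      using legal_move_set_position_iff [of U w R \<Phi> P] w p_eq by (simp add: U_def)
  qed
qed

end
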